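(* Let $(V,g)$ be a Euclidean real vector space of dimension $n$. For all $p,q\ge0$ with $p+q\le n-1$ there is an orthogonal decomposition $$D^{p+1,q+1}=\operatorname{Ker}c\oplus g\,D^{p,q},$$ where $c:D^{p+1,q+1}\to D^{p,q}$ is the contraction map.
   Context: $D^{p,q}=\Lambda^pV^*\otimes\Lambda^qV^*$, identified with bilinear forms $\Lambda^pV\times\Lambda^qV\to\mathbb R$, with product $(\theta_1\otimes\theta_2)\cdot(\theta_3\otimes\theta_4)=(\theta_1\wedge\theta_3)\otimes(\theta_2\wedge\theta_4)$, and $g=\sum_{i=1}^n e_i\otimes e_i\in D^{1,1}$ for an orthonormal basis $(e_i)$ of $V^*$. The contraction is $c\omega(x_1\wedge\dots\wedge x_{p},y_1\wedge\dots\wedge y_{q})=\sum_{j=1}^n\omega(e_j\wedge x_1\wedge\dots\wedge x_{p},e_j\wedge y_1\wedge\dots\wedge y_{q})$ for $\omega\in D^{p+1,q+1}$, with $(e_j)$ an orthonormal basis of $V$. Orthogonality refers to the inner product on $D^{p+1,q+1}$ that is the tensor product of the standard inner products on $\Lambda^{p+1}V^*$ and $\Lambda^{q+1}V^*$. *)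

theory Defs
  imports "HOL-Analysis.Analysis" "HOL-Library.Function_Algebras" "HOL-Library.Set_Algebras"
begin

text \<open>
  A \<open>p\<close>-form on \<open>V\<close> is an alternating multilinear function of lists of \<open>p\<close> vectors, extended by zero
  to lists of any other length, so that equality of forms is equality of functions.
\<close>

definition alt_forms :: "nat \<Rightarrow> ('a::real_vector list \<Rightarrow> real) set" where
  "alt_forms p = {\<alpha>.
     (\<forall>xs. length xs \<noteq> p \<longrightarrow> \<alpha> xs = 0) \<and>
     (\<forall>xs i. length xs = p \<longrightarrow> i < p \<longrightarrow> linear (\<lambda>v. \<alpha> (xs[i := v]))) \<and>
     (\<forall>xs. length xs = p \<longrightarrow> \<not> distinct xs \<longrightarrow> \<alpha> xs = 0)}"

text \<open>
  \<open>D\<^sup>p\<^sup>,\<^sup>q\<close>: bilinear forms on \<open>\<Lambda>\<^sup>p V \<times> \<Lambda>\<^sup>q V\<close>, given by their values on pairs of decomposable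
  multivectors \<open>(x\<^sub>1 \<and> \<dots> \<and> x\<^sub>p, y\<^sub>1 \<and> \<dots> \<and> y\<^sub>q)\<close>.
\<close>

type_synonym 'a double_form = "'a list \<Rightarrow> 'a list \<Rightarrow> real"

definition double_forms :: "nat \<Rightarrow> nat \<Rightarrow> 'a::real_vector double_form set" where
  "double_forms p q = {\<omega>. (\<forall>ys. (\<lambda>xs. \<omega> xs ys) \<in> alt_forms p) \<and> (\<forall>xs. \<omega> xs \<in> alt_forms q)}"

global_interpretation df: vector_space "\<lambda>(r::real) (\<omega>::'a double_form) xs ys. r * \<omega> xs ys"
  defines df_subspace = df.subspace
  by unfold_locales (auto simp: fun_eq_iff algebra_simps)

definition tensor :: "('a list \<Rightarrow> real) \<Rightarrow> ('a list \<Rightarrow> real) \<Rightarrow> 'a double_form" where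
  "tensor \<alpha> \<beta> xs ys = \<alpha> xs * \<beta> ys"

text \<open>
  The sign of the shuffle that moves the positions in \<open>I\<close>, in increasing order, in front of the
  remaining positions of \<open>{..<n}\<close>.
\<close>

definition shuffle_sign :: "nat \<Rightarrow> nat set \<Rightarrow> real" where
  "shuffle_sign n I = (- 1) ^ card {(i, j). i \<in> I \<and> j \<in> {..<n} - I \<and> j < i}"

text \<open>
  The wedge product in the normalisation
  \<open>(\<alpha> \<and> \<beta>)(x\<^sub>1, \<dots>) = \<Sum> sgn \<sigma> \<alpha>(x\<^bsub>\<sigma> 1\<^esub>, \<dots>, x\<^bsub>\<sigma> p\<^esub>) \<beta>(x\<^bsub>\<sigma> (p+1)\<^esub>, \<dots>)\<close>, summed over \<open>(p,r)\<close>-shuffles \<open>\<sigma>\<close>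
  (the determinant convention). Since a \<open>p\<close>-form vanishes on lists of length other than \<open>p\<close>, the sum
  may run over all subsets \<open>I\<close>; only those with \<open>p\<close> elements contribute.
\<close>

definition wedge :: "('a list \<Rightarrow> real) \<Rightarrow> ('a list \<Rightarrow> real) \<Rightarrow> 'a list \<Rightarrow> real" where
  "wedge \<alpha> \<beta> xs = (\<Sum>I\<in>Pow {..<length xs}.
     shuffle_sign (length xs) I * \<alpha> (nths xs I) * \<beta> (nths xs (- I)))"

text \<open>The bilinear extension of \<open>(\<alpha> \<otimes> \<beta>) \<cdot> (\<gamma> \<otimes> \<delta>) = (\<alpha> \<and> \<gamma>) \<otimes> (\<beta> \<and> \<delta>)\<close>; see \<open>df_mult_tensor\<close>.\<close>

definition df_mult :: "'a double_form \<Rightarrow> 'a double_form \<Rightarrow> 'a double_form" where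
  "df_mult \<omega> \<eta> xs ys = (\<Sum>I\<in>Pow {..<length xs}. \<Sum>J\<in>Pow {..<length ys}.
     shuffle_sign (length xs) I * shuffle_sign (length ys) J *
     \<omega> (nths xs I) (nths ys J) * \<eta> (nths xs (- I)) (nths ys (- J)))"

lemma df_mult_tensor:
  "df_mult (tensor \<alpha> \<beta>) (tensor \<gamma> \<delta>) = tensor (wedge \<alpha> \<gamma>) (wedge \<beta> \<delta>)"
  by (simp add: fun_eq_iff df_mult_def tensor_def wedge_def sum_product algebra_simps)

lemma df_mult_add_left: "df_mult (\<omega> + \<omega>') \<eta> = df_mult \<omega> \<eta> + df_mult \<omega>' \<eta>"
  by (simp add: fun_eq_iff df_mult_def sum.distrib algebra_simps)

lemma df_mult_add_right: "df_mult \<omega> (\<eta> + \<eta>') = df_mult \<omega> \<eta> + df_mult \<omega> \<eta>'"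
  by (simp add: fun_eq_iff df_mult_def sum.distrib algebra_simps)

lemma df_mult_scale_left: "df_mult (\<lambda>xs ys. r * \<omega> xs ys) \<eta> = (\<lambda>xs ys. r * df_mult \<omega> \<eta> xs ys)"
  by (simp add: fun_eq_iff df_mult_def sum_distrib_left mult_ac)

lemma df_mult_scale_right: "df_mult \<omega> (\<lambda>xs ys. r * \<eta> xs ys) = (\<lambda>xs ys. r * df_mult \<omega> \<eta> xs ys)"
  by (simp add: fun_eq_iff df_mult_def sum_distrib_left mult_ac)

definition covector :: "'a::euclidean_space \<Rightarrow> 'a list \<Rightarrow> real" where
  "covector v xs = (if length xs = 1 then v \<bullet> hd xs else 0)"

lemma wedge_covectors:
  "wedge (covector u) (covector v) [x, y] = (u \<bullet> x) * (v \<bullet> y) - (u \<bullet> y) * (v \<bullet> x)"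
proof -
  have Pow2: "Pow {..<length [x, y]} = {{}, {0}, {1}, {0, 1}}"
    by (simp add: lessThan_Suc Pow_insert insert_commute)
  have *: "{(i, j). i \<in> {0} \<and> j \<in> {..<2} - {0} \<and> j < i} = ({} :: (nat \<times> nat) set)"
    "{(i, j). i \<in> {1} \<and> j \<in> {..<2} - {1} \<and> j < i} = {(1 :: nat, 0 :: nat)}"
    by force+
  have "shuffle_sign (Suc (Suc 0)) {0} = 1" "shuffle_sign (Suc (Suc 0)) {1} = - 1"
    unfolding shuffle_sign_def numeral_2_eq_2[symmetric] * by simp_all
  then show ?thesis
    unfolding wedge_def Pow2 by (simp add: covector_def nths_Cons)
qed

definition metric_form :: "'a::euclidean_space double_form" where
  "metric_form = (\<Sum>e\<in>Basis. tensor (covector e) (covector e))"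

lemma sum_double_form_apply: "(\<Sum>e\<in>A. F e) xs ys = (\<Sum>e\<in>A. F e xs ys)"
  for F :: "'b \<Rightarrow> 'a double_form"
  by (induction A rule: infinite_finite_induct) auto

lemma metric_form_apply: "metric_form [x] [y] = x \<bullet> y"
  by (simp add: metric_form_def sum_double_form_apply tensor_def covector_def
      euclidean_inner[of x y] inner_commute)

definition contraction :: "'a::euclidean_space double_form \<Rightarrow> 'a double_form" where
  "contraction \<omega> xs ys = (\<Sum>e\<in>Basis. \<omega> (e # xs) (e # ys))"

definition contraction_kernel :: "nat \<Rightarrow> nat \<Rightarrow> 'a::euclidean_space double_form set" where
  "contraction_kernel p q = {\<omega> \<in> double_forms p q. contraction \<omega> = 0}"

definition metric_multiples :: "nat \<Rightarrow> nat \<Rightarrow> 'a::euclidean_space double_form set" where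
  "metric_multiples p q = df_mult metric_form ` double_forms p q"

text \<open>
  The standard inner product on \<open>p\<close>-forms, for which the \<open>e\<^bsub>i\<^sub>1\<^esub> \<and> \<dots> \<and> e\<^bsub>i\<^sub>p\<^esub>\<close> with \<open>i\<^sub>1 < \<dots> < i\<^sub>p\<close> are
  orthonormal: the sum of \<open>\<alpha>(e\<^sub>I) \<beta>(e\<^sub>I)\<close> over \<open>p\<close>-element sets \<open>I\<close> of basis vectors. The basis carries no
  order, so all \<open>p!\<close> enumerations of each set are counted; lists with repetitions contribute 0.
\<close>

definition form_inner :: "nat \<Rightarrow> ('a::euclidean_space list \<Rightarrow> real) \<Rightarrow> ('a list \<Rightarrow> real) \<Rightarrow> real" where
  "form_inner p \<alpha> \<beta> = (\<Sum>xs | set xs \<subseteq> Basis \<and> length xs = p. \<alpha> xs * \<beta> xs) / fact p"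

definition df_inner :: "nat \<Rightarrow> nat \<Rightarrow> 'a::euclidean_space double_form \<Rightarrow> 'a double_form \<Rightarrow> real" where
  "df_inner p q \<omega> \<eta> =
     (\<Sum>xs | set xs \<subseteq> Basis \<and> length xs = p. \<Sum>ys | set ys \<subseteq> Basis \<and> length ys = q.
        \<omega> xs ys * \<eta> xs ys) / (fact p * fact q)"

lemma df_inner_tensor:
  "df_inner p q (tensor \<alpha> \<beta>) (tensor \<gamma> \<delta>) = form_inner p \<alpha> \<gamma> * form_inner q \<beta> \<delta>"
  by (simp add: df_inner_def form_inner_def tensor_def sum_product mult_ac)

lemma alt_forms_linear:
  "\<alpha> \<in> alt_forms p \<Longrightarrow> length xs = p \<Longrightarrow> i < p \<Longrightarrow> linear (\<lambda>v. \<alpha> (xs[i := v]))"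
  by (simp add: alt_forms_def)

lemma alt_forms_linear_hd:
  assumes "\<alpha> \<in> alt_forms (Suc p)" "length xs = p"
  shows "linear (\<lambda>v. \<alpha> (v # xs))"
proof -
  have "linear (\<lambda>v. \<alpha> ((0 # xs)[0 := v]))"
    by (rule alt_forms_linear[OF assms(1)]) (use assms(2) in simp_all)
  then show ?thesis by simp
qed

text \<open>The contraction does not depend on the orthonormal basis used to define it.\<close>

lemma contraction_orthonormal_basis:
  fixes \<omega> :: "'a::euclidean_space double_form"
  assumes \<omega>: "\<omega> \<in> double_forms (Suc p) (Suc q)" and len: "length xs = p" "length ys = q"
    and B: "finite B" "\<And>u v. u \<in> B \<Longrightarrow> v \<in> B \<Longrightarrow> u \<bullet> v = (if u = v then 1 else 0)" "span B = UNIV"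
  shows "contraction \<omega> xs ys = (\<Sum>e\<in>B. \<omega> (e # xs) (e # ys))"
proof -
  define h where "h u v = \<omega> (u # xs) (v # ys)" for u v
  have l1: "linear (\<lambda>u. h u v)" for v
    using alt_forms_linear_hd[of "\<lambda>xs. \<omega> xs (v # ys)" p xs] \<omega> len
    by (simp add: double_forms_def h_def)
  have l2: "linear (h u)" for u
    using alt_forms_linear_hd[of "\<omega> (u # xs)" q ys] \<omega> len
    by (simp add: double_forms_def h_def[abs_def])
  have exp: "x = (\<Sum>b\<in>B. (x \<bullet> b) *\<^sub>R b)" for x
  proof -
    have "x \<in> span B" using B by simp
    then obtain c where c: "x = (\<Sum>b\<in>B. c b *\<^sub>R b)"
      using span_finite[OF B(1)] by auto
    have "x \<bullet> b = c b" if "b \<in> B" for b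
    proof -
      have "x \<bullet> b = (\<Sum>a\<in>B. c a * (if a = b then 1 else 0))"
        unfolding c inner_sum_left using B(2) that by (intro sum.cong) auto
      then show ?thesis using that B(1) by (simp add: if_distrib cong: if_cong)
    qed
    then show ?thesis by (subst c) (intro sum.cong, auto)
  qed
  have hexp: "h u u = (\<Sum>a\<in>B. \<Sum>b\<in>B. (u \<bullet> a) * (u \<bullet> b) * h a b)" for u
  proof -
    have "h u u = h (\<Sum>a\<in>B. (u \<bullet> a) *\<^sub>R a) u"
      by (simp flip: exp)
    also have "\<dots> = (\<Sum>a\<in>B. (u \<bullet> a) * h a u)"
      by (simp add: linear_sum[OF l1] linear_scale[OF l1])
    also have "\<dots> = (\<Sum>a\<in>B. (u \<bullet> a) * h a (\<Sum>b\<in>B. (u \<bullet> b) *\<^sub>R b))"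
      by (simp flip: exp)
    also have "\<dots> = (\<Sum>a\<in>B. \<Sum>b\<in>B. (u \<bullet> a) * (u \<bullet> b) * h a b)"
      by (simp add: linear_sum[OF l2] linear_scale[OF l2] sum_distrib_left mult_ac)
    finally show ?thesis .
  qed
  have basis_inner: "a \<bullet> b = (\<Sum>u\<in>Basis. (u \<bullet> a) * (u \<bullet> b))" for a b :: 'a
    using euclidean_inner[of a b] by (simp only: inner_commute)
  have "contraction \<omega> xs ys = (\<Sum>u\<in>Basis. \<Sum>a\<in>B. \<Sum>b\<in>B. (u \<bullet> a) * (u \<bullet> b) * h a b)"
    unfolding contraction_def h_def[symmetric] by (rule sum.cong[OF refl hexp])
  also have "\<dots> = (\<Sum>a\<in>B. \<Sum>u\<in>Basis. \<Sum>b\<in>B. (u \<bullet> a) * (u \<bullet> b) * h a b)"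
    by (rule sum.swap)
  also have "\<dots> = (\<Sum>a\<in>B. \<Sum>b\<in>B. \<Sum>u\<in>Basis. (u \<bullet> a) * (u \<bullet> b) * h a b)"
    by (rule sum.cong[OF refl], rule sum.swap)
  also have "\<dots> = (\<Sum>a\<in>B. \<Sum>b\<in>B. (a \<bullet> b) * h a b)"
    by (intro sum.cong refl) (simp flip: basis_inner sum_distrib_right)
  also have "\<dots> = (\<Sum>a\<in>B. h a a)"
  proof (intro sum.cong refl)
    fix a assume a: "a \<in> B"
    have "(\<Sum>b\<in>B. (a \<bullet> b) * h a b) = (\<Sum>b\<in>B. if a = b then h a b else 0)"
      using a B(2) by (intro sum.cong) auto
    then show "(\<Sum>b\<in>B. (a \<bullet> b) * h a b) = h a a"
      using a B(1) by simp
  qed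
  finally show ?thesis by (simp add: h_def)
qed

lemma contraction_double_forms:
  fixes \<omega> :: "'a::euclidean_space double_form"
  assumes "\<omega> \<in> double_forms (p + 1) (q + 1)"
  shows "contraction \<omega> \<in> double_forms p q"
proof -
  have cons: "(\<lambda>xs. \<alpha> (e # xs)) \<in> alt_forms r" if "\<alpha> \<in> alt_forms (Suc r)"
    for \<alpha> :: "'a list \<Rightarrow> real" and e r
  proof -
    have "linear (\<lambda>v. \<alpha> (e # xs[i := v]))" if "length xs = r" "i < r" for xs i
    proof -
      have "linear (\<lambda>v. \<alpha> ((e # xs)[Suc i := v]))"
        by (rule alt_forms_linear[OF \<open>\<alpha> \<in> alt_forms (Suc r)\<close>]) (use that in simp_all)
      then show ?thesis by simp
    qed
    with that show ?thesis by (auto simp: alt_forms_def)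
  qed
  have sums: "(\<lambda>xs. \<Sum>e\<in>Basis. A e xs) \<in> alt_forms r" if "\<And>e. A e \<in> alt_forms r"
    for A :: "'a \<Rightarrow> 'a list \<Rightarrow> real" and r
    using that unfolding alt_forms_def by (auto intro!: linear_compose_sum)
  show ?thesis
    unfolding double_forms_def mem_Collect_eq
  proof (intro conjI allI)
    fix ys
    have "(\<lambda>xs. \<omega> (e # xs) (e # ys)) \<in> alt_forms p" for e
      using assms by (intro cons[of "\<lambda>xs. \<omega> xs (e # ys)"]) (simp add: double_forms_def)
    then show "(\<lambda>xs. contraction \<omega> xs ys) \<in> alt_forms p"
      unfolding contraction_def by (rule sums)
  next
    fix xs
    have "(\<lambda>ys. \<omega> (e # xs) (e # ys)) \<in> alt_forms q" for e
      using assms by (intro cons) (simp add: double_forms_def)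
    then show "contraction \<omega> xs \<in> alt_forms q"
      unfolding contraction_def[abs_def] by (rule sums)
  qed
qed

end

theory Submission
  imports Defs
begin

text \<open>
  Multiplication by the metric is the adjoint of the contraction, up to factors absorbed by the
  normalisation of the inner product. Hence the orthogonal complement of \<open>g D\<^sup>p\<^sup>,\<^sup>q\<close> is the kernel of
  \<open>c\<close>, and finite dimensionality gives the decomposition. The adjointness reduces, one factor at a
  time, to that of \<open>\<alpha> \<mapsto> e \<and> \<alpha>\<close> and the interior product with \<open>e\<close>.
\<close>

section \<open>Alternating forms\<close>

lemma alt_forms_length: "\<alpha> \<in> alt_forms p \<Longrightarrow> length xs \<noteq> p \<Longrightarrow> \<alpha> xs = 0"
  by (simp add: alt_forms_def)

lemma alt_forms_not_distinct: "\<alpha> \<in> alt_forms p \<Longrightarrow> \<not> distinct xs \<Longrightarrow> \<alpha> xs = 0"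
  by (cases "length xs = p") (auto simp: alt_forms_def)

lemma alt_forms_linear_middle:
  assumes "\<alpha> \<in> alt_forms (length as + Suc (length bs))"
  shows "linear (\<lambda>v. \<alpha> (as @ v # bs))"
  using alt_forms_linear[OF assms, of "as @ 0 # bs" "length as"] by simp

text \<open>This is the interior product with \<open>e\<close>, up to the choice of sign convention.
  It lowers the degree in the induction of \<open>alt_forms_eq_zero\<close>.\<close>

lemma alt_forms_cons:
  assumes "\<alpha> \<in> alt_forms (Suc p)"
  shows "(\<lambda>xs. \<alpha> (e # xs)) \<in> alt_forms p"
proof -
  have "linear (\<lambda>v. \<alpha> (e # xs[i := v]))" if "length xs = p" "i < p" for xs i
    using alt_forms_linear[OF assms, of "e # xs" "Suc i"] that by simp
  with assms show ?thesis by (auto simp: alt_forms_def)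
qed

lemma alt_forms_zero: "(\<lambda>_. 0) \<in> alt_forms p"
  by (auto simp: alt_forms_def intro: linear_zero)

lemma alt_forms_add:
  "\<alpha> \<in> alt_forms p \<Longrightarrow> \<beta> \<in> alt_forms p \<Longrightarrow> (\<lambda>xs. \<alpha> xs + \<beta> xs) \<in> alt_forms p"
  by (auto simp: alt_forms_def intro: linear_compose_add)

lemma alt_forms_scale: "\<alpha> \<in> alt_forms p \<Longrightarrow> (\<lambda>xs. r * \<alpha> xs) \<in> alt_forms p"
  using linear_compose_scale_right[where 'b = real and c = r] by (auto simp: alt_forms_def)

lemma alt_forms_sum:
  "(\<And>i. i \<in> A \<Longrightarrow> F i \<in> alt_forms p) \<Longrightarrow> (\<lambda>xs. \<Sum>i\<in>A. F i xs) \<in> alt_forms p"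
  by (induction A rule: infinite_finite_induct) (simp_all add: alt_forms_zero alt_forms_add)

text \<open>Alternation is encoded as vanishing on repeated entries, so antisymmetry comes from
  polarisation: expand the value 0 at two adjacent entries \<open>u + v\<close> and drop the terms
  with \<open>u, u\<close> and \<open>v, v\<close>.\<close>

lemma alt_forms_swap:
  assumes \<alpha>: "\<alpha> \<in> alt_forms p"
  shows "\<alpha> (as @ u # v # bs) = - \<alpha> (as @ v # u # bs)"
proof (cases "p = length as + Suc (Suc (length bs))")
  case True
  have l1: "linear (\<lambda>x. \<alpha> (as @ x # y # bs))" for y
    using alt_forms_linear_middle[of \<alpha> as "y # bs"] \<alpha> True by simp
  have l2: "linear (\<lambda>y. \<alpha> (as @ x # y # bs))" for x
    using alt_forms_linear_middle[of \<alpha> "as @ [x]" bs] \<alpha> True by simp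
  have "0 = \<alpha> (as @ (u + v) # (u + v) # bs)"
    by (simp add: alt_forms_not_distinct[OF \<alpha>])
  also have "\<dots> = \<alpha> (as @ u # v # bs) + \<alpha> (as @ v # u # bs)"
    by (simp add: linear_add[OF l1] linear_add[OF l2] alt_forms_not_distinct[OF \<alpha>])
  finally show ?thesis by simp
qed (simp add: alt_forms_length[OF \<alpha>])

text \<open>Each adjacent swap costs one sign. The induction runs from the right end of
  \<open>bs\<close>, because its last entry is the neighbour of \<open>x\<close>; that entry then
  joins \<open>cs\<close>, which is therefore kept arbitrary.\<close>

lemma alt_forms_move:
  assumes "\<alpha> \<in> alt_forms p"
  shows "\<alpha> (as @ bs @ x # cs) = (- 1) ^ length bs * \<alpha> (as @ x # bs @ cs)"
proof (induction bs arbitrary: cs rule: rev_induct)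
  case (snoc b bs)
  have "\<alpha> (as @ (bs @ [b]) @ x # cs) = - \<alpha> (as @ bs @ x # b # cs)"
    using alt_forms_swap[OF assms, of "as @ bs" b x cs] by simp
  also have "\<dots> = (- 1) ^ length (bs @ [b]) * \<alpha> (as @ x # (bs @ [b]) @ cs)"
    by (simp add: snoc.IH)
  finally show ?case .
qed simp

text \<open>Multilinearity: expand the head in the orthonormal basis and treat the tail by
  induction, since fixing the head leaves a form of degree \<open>p\<close>. Lists of the wrong
  length are covered by the extension by zero.\<close>

lemma alt_forms_eq_zero:
  fixes \<alpha> :: "'a::euclidean_space list \<Rightarrow> real"
  assumes "\<alpha> \<in> alt_forms p" "\<And>xs. set xs \<subseteq> Basis \<Longrightarrow> length xs = p \<Longrightarrow> \<alpha> xs = 0"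
  shows "\<alpha> xs = 0"
  using assms
proof (induction p arbitrary: \<alpha> xs)
  case 0
  then show ?case by (cases xs) (auto dest: alt_forms_length)
next
  case (Suc p)
  show ?case
  proof (cases "length xs = Suc p")
    case True
    then obtain y ys where xs: "xs = y # ys" "length ys = p"
      by (auto simp: length_Suc_conv)
    have "\<alpha> (e # ys) = 0" if "e \<in> Basis" for e
      using Suc.IH[of "\<lambda>zs. \<alpha> (e # zs)" ys] alt_forms_cons[OF Suc.prems(1)] Suc.prems(2) that
      by simp
    moreover have "\<alpha> (y # ys) = (\<Sum>e\<in>Basis. (y \<bullet> e) * \<alpha> (e # ys))"
    proof -
      note lin = alt_forms_linear_hd[OF Suc.prems(1) xs(2)]
      have "\<alpha> (y # ys) = \<alpha> ((\<Sum>e\<in>Basis. (y \<bullet> e) *\<^sub>R e) # ys)"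
        by (simp only: euclidean_representation)
      then show ?thesis
        by (simp add: linear_sum[OF lin] linear_scale[OF lin])
    qed
    ultimately show ?thesis by (simp add: xs(1))
  qed (simp add: alt_forms_length[OF Suc.prems(1)])
qed

section \<open>Exterior multiplication by a covector\<close>

lemma shuffle_sign_singleton: "i < n \<Longrightarrow> shuffle_sign n {i} = (- 1) ^ i"
proof -
  assume "i < n"
  then have "{(k, j). k \<in> {i} \<and> j \<in> {..<n} - {i} \<and> j < k} = {i} \<times> {..<i}"
    by auto
  then show ?thesis
    unfolding shuffle_sign_def by simp
qed

lemma nths_singleton: "i < length xs \<Longrightarrow> nths xs {i} = [xs ! i]"
proof (induction xs arbitrary: i)
  case (Cons x xs)
  show ?case
  proof (cases i)
    case (Suc j)
    then have "{k. Suc k \<in> {i}} = {j}" by auto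
    with Cons Suc show ?thesis by (simp add: nths_Cons)
  qed (simp add: nths_Cons)
qed simp

lemma nths_Compl_singleton: "nths xs (- {i}) = take i xs @ drop (Suc i) xs"
proof (induction xs arbitrary: i)
  case (Cons x xs)
  show ?case
  proof (cases i)
    case 0
    then have "{k. Suc k \<in> - {i}} = UNIV" by auto
    with 0 show ?thesis by (simp add: nths_Cons nths_all)
  next
    case (Suc j)
    then have "{k. Suc k \<in> - {i}} = - {j}" by auto
    with Cons Suc show ?thesis by (simp add: nths_Cons)
  qed
qed simp

text \<open>A covector vanishes on lists of length other than 1, so only singletons
  \<open>I = {i}\<close> survive in the shuffle sum. The result is the Laplace expansion that
  deletes one entry at a time.\<close>

lemma wedge_covector:
  "wedge (covector v) \<alpha> xs =
    (\<Sum>i<length xs. (- 1) ^ i * (v \<bullet> xs ! i) * \<alpha> (take i xs @ drop (Suc i) xs))"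
proof -
  let ?f = "\<lambda>I. shuffle_sign (length xs) I * covector v (nths xs I) * \<alpha> (nths xs (- I))"
  have "wedge (covector v) \<alpha> xs = sum ?f ((\<lambda>i. {i}) ` {..<length xs})"
    unfolding wedge_def
  proof (rule sum.mono_neutral_right)
    show "\<forall>I \<in> Pow {..<length xs} - (\<lambda>i. {i}) ` {..<length xs}. ?f I = 0"
    proof
      fix I assume I: "I \<in> Pow {..<length xs} - (\<lambda>i. {i}) ` {..<length xs}"
      then have "card I \<noteq> 1" by (auto simp: card_1_singleton_iff)
      moreover have "{i. i < length xs \<and> i \<in> I} = I" using I by auto
      ultimately show "?f I = 0" by (simp add: covector_def length_nths)
    qed
  qed auto
  also have "\<dots> = (\<Sum>i<length xs. (- 1) ^ i * (v \<bullet> xs ! i) * \<alpha> (take i xs @ drop (Suc i) xs))"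
    by (subst sum.reindex)
      (auto simp: inj_on_def shuffle_sign_singleton nths_singleton nths_Compl_singleton covector_def
        intro!: sum.cong)
  finally show ?thesis .
qed

text \<open>Each term of the Laplace expansion is linear in entry \<open>k\<close>: through the
  inner product if \<open>k\<close> is the deleted position, and through \<alpha> otherwise.\<close>

lemma wedge_covector_linear:
  assumes \<alpha>: "\<alpha> \<in> alt_forms p" and k: "k < Suc p" and xs: "length xs = Suc p"
  shows "linear (\<lambda>v. wedge (covector u) \<alpha> (xs[k := v]))"
proof -
  have "linear (\<lambda>v. (- 1) ^ i * (u \<bullet> xs[k := v] ! i) *
      \<alpha> (take i (xs[k := v]) @ drop (Suc i) (xs[k := v])))" (is "linear ?f")
    if i: "i < Suc p" for i
  proof (cases "i = k")
    case True
    have "?f = (\<lambda>v. ((- 1) ^ i * \<alpha> (take i xs @ drop (Suc i) xs)) * (u \<bullet> v))"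
      using True k xs by (simp add: fun_eq_iff)
    then show ?thesis
      by (simp add: linear_iff algebra_simps)
  next
    case False
    \<comment> \<open>The position of the old entry \<open>k\<close> once entry \<open>i\<close> has
      been deleted.\<close>
    define j where "j = (if k < i then k else k - 1)"
    let ?r = "take i xs @ drop (Suc i) xs"
    have "take i (xs[k := v]) @ drop (Suc i) (xs[k := v]) = ?r[j := v]" for v
      using False i k xs
      by (auto simp: j_def list_update_append take_update_swap drop_update_swap
        list_update_beyond not_less)
    then have "?f = (\<lambda>v. ((- 1) ^ i * (u \<bullet> xs ! i)) * \<alpha> (?r[j := v]))"
      using False by (simp add: fun_eq_iff)
    moreover have "linear (\<lambda>v. \<alpha> (?r[j := v]))"
      using False i k xs by (intro alt_forms_linear[OF \<alpha>]) (auto simp: j_def)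
    ultimately show ?thesis
      by (simp add: linear_iff algebra_simps)
  qed
  then show ?thesis
    unfolding wedge_covector length_list_update xs by (intro linear_compose_sum) auto
qed

text \<open>Let \<open>x\<close> occur at positions \<open>a < b\<close>. Deleting any other entry
  keeps both copies, so that term vanishes. The terms for \<open>a\<close> and \<open>b\<close>
  cancel after one copy of \<open>x\<close> is moved across \<open>bs\<close>.\<close>

lemma wedge_covector_not_distinct:
  assumes \<alpha>: "\<alpha> \<in> alt_forms p" and xs: "\<not> distinct xs"
  shows "wedge (covector u) \<alpha> xs = 0"
proof -
  obtain as bs cs x where dec: "xs = as @ x # bs @ x # cs"
    using not_distinct_decomp[OF xs] by auto
  define a b where "a = length as" and "b = length as + Suc (length bs)"
  let ?f = "\<lambda>i. (- 1) ^ i * (u \<bullet> xs ! i) * \<alpha> (take i xs @ drop (Suc i) xs)"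
  have ab: "a < length xs" "b < length xs" "a \<noteq> b" "xs ! a = x" "xs ! b = x"
    by (auto simp: a_def b_def dec nth_append)
  have "?f i = 0" if "i < length xs" "i \<noteq> a" "i \<noteq> b" for i
  proof -
    have "\<not> distinct (take i xs @ drop (Suc i) xs)"
    proof
      assume d: "distinct (take i xs @ drop (Suc i) xs)"
      \<comment> \<open>Deleting entry \<open>i\<close> sends position \<open>m\<close> to
        \<open>j m\<close>. The two copies of \<open>x\<close> land at different positions, which
        contradicts distinctness.\<close>
      define j where "j m = (if m < i then m else m - 1)" for m
      have nth: "(take i xs @ drop (Suc i) xs) ! j m = xs ! m" "j m < length xs - 1"
        if "m < length xs" "m \<noteq> i" for m
        using that \<open>i < length xs\<close> by (auto simp: j_def nth_append)
      have "j a \<noteq> j b"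
        using that ab by (auto simp: j_def a_def b_def)
      moreover have "length (take i xs @ drop (Suc i) xs) = length xs - 1"
        using that by simp
      ultimately show False
        using nth_eq_iff_index_eq[OF d, of "j a" "j b"] nth[of a] nth[of b] that ab by simp
    qed
    then show ?thesis by (simp add: alt_forms_not_distinct[OF \<alpha>])
  qed
  then have "wedge (covector u) \<alpha> xs = sum ?f {a, b}"
    unfolding wedge_covector using ab by (intro sum.mono_neutral_right) auto
  also have "\<dots> = ?f a + ?f b"
    using ab by simp
  also have "\<dots> = (- 1) ^ a * (u \<bullet> x) * \<alpha> (as @ bs @ x # cs) + (- 1) ^ b * (u \<bullet> x) * \<alpha> (as @ x # bs @ cs)"
    unfolding ab by (simp add: a_def b_def dec)
  \<comment> \<open>Moving \<open>x\<close> gives the sign \<open>(- 1) ^ length bs\<close>, while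
    \<open>b - a\<close> is \<open>length bs + 1\<close>, so the two terms have opposite
    signs.\<close>
  also have "\<dots> = 0"
    by (simp add: alt_forms_move[OF \<alpha>] a_def b_def power_add)
  finally show ?thesis .
qed

lemma wedge_covector_alt_forms:
  assumes "\<alpha> \<in> alt_forms p"
  shows "wedge (covector u) \<alpha> \<in> alt_forms (Suc p)"
proof -
  have "wedge (covector u) \<alpha> xs = 0" if "length xs \<noteq> Suc p" for xs
    unfolding wedge_covector using that
    by (intro sum.neutral) (auto simp: alt_forms_length[OF assms])
  then show ?thesis
    using assms by (simp add: alt_forms_def[of "Suc p"] wedge_covector_linear wedge_covector_not_distinct)
qed

text \<open>Deleting the entry at position \<open>i\<close> and inserting it again are mutually
  inverse. Taking \<open>i\<close> to be the position deleted in a term of the Laplace expansion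
  separates the entry paired with the covector from those fed to \<alpha>.\<close>

lemma sum_basis_lists_Suc:
  fixes F :: "'a::euclidean_space list \<Rightarrow> real"
  assumes "i \<le> p"
  shows "(\<Sum>xs | set xs \<subseteq> Basis \<and> length xs = Suc p. F xs) =
    (\<Sum>b\<in>Basis. \<Sum>zs | set zs \<subseteq> Basis \<and> length zs = p. F (take i zs @ b # drop i zs))"
  unfolding sum.cartesian_product
proof (rule sum.reindex_bij_witness[where
      j = "\<lambda>xs. (xs ! i, take i xs @ drop (Suc i) xs)" and i = "\<lambda>(b, zs). take i zs @ b # drop i zs"])
  fix xs :: "'a list" assume xs: "xs \<in> {xs. set xs \<subseteq> Basis \<and> length xs = Suc p}"
  then have i: "i < length xs" using assms by simp
  let ?r = "take i xs @ drop (Suc i) xs"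
  have eq: "take i ?r @ xs ! i # drop i ?r = xs"
    using i id_take_nth_drop[OF i] by simp
  then show "(case (xs ! i, ?r) of (b, zs) \<Rightarrow> take i zs @ b # drop i zs) = xs"
    "(case (xs ! i, ?r) of (b, zs) \<Rightarrow> F (take i zs @ b # drop i zs)) = F xs"
    by (simp_all only: prod.case)
  have "set ?r \<subseteq> set xs" "xs ! i \<in> set xs"
    using i by (auto dest: in_set_takeD in_set_dropD)
  moreover have "length ?r = p"
    using xs assms by simp
  ultimately show "(xs ! i, ?r) \<in> Basis \<times> {zs. set zs \<subseteq> Basis \<and> length zs = p}"
    using xs by blast
next
  fix bz :: "'a \<times> 'a list" assume bz: "bz \<in> Basis \<times> {zs. set zs \<subseteq> Basis \<and> length zs = p}"
  obtain b zs where bz_eq: "bz = (b, zs)" by (cases bz)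
  let ?x = "take i zs @ b # drop i zs"
  have "set ?x = insert b (set zs)"
    by (metis Un_insert_right append_take_drop_id list.set(2) set_append)
  moreover have "length ?x = Suc p"
    using bz assms by (simp add: bz_eq)
  ultimately show "(case bz of (b, zs) \<Rightarrow> take i zs @ b # drop i zs) \<in>
      {xs. set xs \<subseteq> Basis \<and> length xs = Suc p}"
    using bz by (simp add: bz_eq)
  have "?x ! i = b" "take i ?x @ drop (Suc i) ?x = zs"
    using bz assms by (simp_all add: bz_eq nth_append)
  then show "((case bz of (b, zs) \<Rightarrow> take i zs @ b # drop i zs) ! i,
      take i (case bz of (b, zs) \<Rightarrow> take i zs @ b # drop i zs) @
      drop (Suc i) (case bz of (b, zs) \<Rightarrow> take i zs @ b # drop i zs)) = bz"
    by (simp only: bz_eq prod.case)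
qed

text \<open>The factor \<open>Suc p\<close> is the ratio of the factorials in the inner products.\<close>

lemma wedge_covector_adjoint:
  fixes \<alpha> \<beta> :: "'a::euclidean_space list \<Rightarrow> real"
  assumes \<beta>: "\<beta> \<in> alt_forms (Suc p)" and e: "e \<in> Basis"
  shows "(\<Sum>xs | set xs \<subseteq> Basis \<and> length xs = Suc p. wedge (covector e) \<alpha> xs * \<beta> xs) =
    Suc p * (\<Sum>zs | set zs \<subseteq> Basis \<and> length zs = p. \<alpha> zs * \<beta> (e # zs))"
proof -
  let ?L = "\<lambda>p. {xs :: 'a list. set xs \<subseteq> Basis \<and> length xs = p}"
  let ?t = "\<lambda>i xs. (- 1) ^ i * (e \<bullet> xs ! i) * \<alpha> (take i xs @ drop (Suc i) xs) * \<beta> xs"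
  have "(\<Sum>xs\<in>?L (Suc p). ?t i xs) = (\<Sum>zs\<in>?L p. \<alpha> zs * \<beta> (e # zs))" if i: "i < Suc p" for i
  proof -
    have "(\<Sum>xs\<in>?L (Suc p). ?t i xs) = (\<Sum>b\<in>Basis. \<Sum>zs\<in>?L p. ?t i (take i zs @ b # drop i zs))"
      using i by (intro sum_basis_lists_Suc) simp
    \<comment> \<open>Orthonormality leaves only \<open>b = e\<close>. Moving \<open>b\<close> to
      the front in \<beta> produces a second \<open>(- 1) ^ i\<close>, which cancels the sign of the
      expansion. Hence all \<open>Suc p\<close> positions contribute equally.\<close>
    also have "\<dots> = (\<Sum>b\<in>Basis. \<Sum>zs\<in>?L p. (if b = e then \<alpha> zs * \<beta> (b # zs) else 0))"
    proof (intro sum.cong refl)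
      fix b :: 'a and zs assume b: "b \<in> Basis" and "zs \<in> ?L p"
      moreover have "\<beta> (take i zs @ b # drop i zs) = (- 1) ^ min (length zs) i * \<beta> (b # zs)"
        using alt_forms_move[OF \<beta>, of "[]" "take i zs" b "drop i zs"] by simp
      ultimately show "?t i (take i zs @ b # drop i zs) = (if b = e then \<alpha> zs * \<beta> (b # zs) else 0)"
        using i e by (auto simp: nth_append inner_Basis simp flip: power_mult_distrib)
    qed
    also have "\<dots> = (\<Sum>zs\<in>?L p. \<alpha> zs * \<beta> (e # zs))"
      using e by (subst sum.swap) simp
    finally show ?thesis .
  qed
  moreover have "(\<Sum>xs\<in>?L (Suc p). wedge (covector e) \<alpha> xs * \<beta> xs) =
      (\<Sum>i<Suc p. \<Sum>xs\<in>?L (Suc p). ?t i xs)"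
    by (subst sum.swap) (auto simp: wedge_covector sum_distrib_right simp del: sum.lessThan_Suc intro!: sum.cong)
  ultimately show ?thesis by simp
qed

section \<open>Double forms\<close>

lemma df_subspace_iff:
  "df_subspace S \<longleftrightarrow> 0 \<in> S \<and> (\<forall>\<omega>\<in>S. \<forall>\<eta>\<in>S. \<omega> + \<eta> \<in> S) \<and>
    (\<forall>r. \<forall>\<omega>\<in>S. (\<lambda>xs ys. r * \<omega> xs ys) \<in> S)"
  by (auto simp: df.subspace_def)

lemma df_subspace_double_forms: "df_subspace (double_forms p q)"
  unfolding df_subspace_iff
  by (auto simp: double_forms_def zero_fun_def plus_fun_def alt_forms_zero alt_forms_add alt_forms_scale)

text \<open>Apply \<open>alt_forms_eq_zero\<close> in one argument at a time: first in
  \<open>ys\<close> with \<open>xs\<close> a basis list, then in \<open>xs\<close> with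
  \<open>ys\<close> arbitrary.\<close>

lemma double_forms_eq_zero:
  fixes \<omega> :: "'a::euclidean_space double_form"
  assumes \<omega>: "\<omega> \<in> double_forms p q"
    and zero: "\<And>xs ys. set xs \<subseteq> Basis \<Longrightarrow> length xs = p \<Longrightarrow> set ys \<subseteq> Basis \<Longrightarrow> length ys = q \<Longrightarrow> \<omega> xs ys = 0"
  shows "\<omega> = 0"
proof (intro ext)
  fix xs ys
  have "\<omega> xs ys = 0" if "set xs \<subseteq> Basis" "length xs = p" for xs ys
  proof (rule alt_forms_eq_zero)
    show "\<omega> xs \<in> alt_forms q" using \<omega> by (simp add: double_forms_def)
  qed (rule zero[OF that])
  then show "\<omega> xs ys = 0 xs ys"
    using \<omega> alt_forms_eq_zero[of "\<lambda>xs. \<omega> xs ys" p xs] by (simp add: double_forms_def)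
qed

lemma df_inner_commute: "df_inner p q \<omega> \<eta> = df_inner p q \<eta> \<omega>"
  by (simp add: df_inner_def mult.commute)

text \<open>Definiteness on double forms: a vanishing sum of squares kills all values on basis
  lists, and these determine the form.\<close>

lemma df_inner_self_eq_zero:
  fixes \<omega> :: "'a::euclidean_space double_form"
  assumes "\<omega> \<in> double_forms p q" "df_inner p q \<omega> \<omega> = 0"
  shows "\<omega> = 0"
proof (rule double_forms_eq_zero[OF assms(1)])
  have fin: "finite {xs :: 'a list. set xs \<subseteq> Basis \<and> length xs = r}" for r
    by (simp add: finite_lists_length_eq)
  fix xs ys :: "'a list"
  assume "set xs \<subseteq> Basis" "length xs = p" "set ys \<subseteq> Basis" "length ys = q"
  then show "\<omega> xs ys = 0"
    using assms(2) fin by (auto simp: df_inner_def sum_nonneg_eq_0_iff sum_nonneg)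
qed

text \<open>The signs and the factor \<open>tensor (covector e) (covector e)\<close> split into an
  \<open>xs\<close> part and a \<open>ys\<close> part. Multiplication by the metric thus becomes
  exterior multiplication by \<open>e\<close> in each argument, summed over \<open>e\<close>, and
  the results on single covectors apply.\<close>

lemma df_mult_metric_form:
  "df_mult metric_form \<omega> xs ys =
    (\<Sum>e\<in>Basis. wedge (covector e) (\<lambda>zs. wedge (covector e) (\<omega> zs) ys) xs)"
proof -
  let ?s = "\<lambda>e I J. shuffle_sign (length xs) I * shuffle_sign (length ys) J *
    (covector e (nths xs I) * covector e (nths ys J)) * \<omega> (nths xs (- I)) (nths ys (- J))"
  have "df_mult metric_form \<omega> xs ys =
      (\<Sum>I\<in>Pow {..<length xs}. \<Sum>J\<in>Pow {..<length ys}. \<Sum>e\<in>Basis. ?s e I J)"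
    by (simp add: df_mult_def metric_form_def sum_double_form_apply tensor_def
        sum_distrib_left sum_distrib_right)
  also have "\<dots> = (\<Sum>I\<in>Pow {..<length xs}. \<Sum>e\<in>Basis. \<Sum>J\<in>Pow {..<length ys}. ?s e I J)"
    by (rule sum.cong[OF refl], rule sum.swap)
  also have "\<dots> = (\<Sum>e\<in>Basis. \<Sum>I\<in>Pow {..<length xs}. \<Sum>J\<in>Pow {..<length ys}. ?s e I J)"
    by (rule sum.swap)
  finally show ?thesis
    by (simp add: wedge_def sum_distrib_left mult_ac)
qed

lemma df_mult_metric_form_double_forms:
  fixes \<omega> :: "'a::euclidean_space double_form"
  assumes \<omega>: "\<omega> \<in> double_forms p q"
  shows "df_mult metric_form \<omega> \<in> double_forms (Suc p) (Suc q)"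
  unfolding double_forms_def mem_Collect_eq
proof (intro conjI allI)
  have inner_q: "wedge (covector e) (\<omega> zs) \<in> alt_forms (Suc q)" for e zs
    using \<omega> by (intro wedge_covector_alt_forms) (simp add: double_forms_def)
  have inner_p: "(\<lambda>zs. wedge (covector e) (\<omega> zs) ys) \<in> alt_forms p" for e ys
    unfolding wedge_covector using \<omega>
    by (intro alt_forms_sum alt_forms_scale) (simp add: double_forms_def)
  show "(\<lambda>xs. df_mult metric_form \<omega> xs ys) \<in> alt_forms (Suc p)" for ys
    unfolding df_mult_metric_form by (intro alt_forms_sum wedge_covector_alt_forms inner_p)
  \<comment> \<open>Only the outer wedge product is expanded. For fixed \<open>xs\<close> this
    leaves a linear combination of the forms
    \<open>wedge (covector e) (\<omega> zs)\<close>.\<close>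
  show "df_mult metric_form \<omega> xs \<in> alt_forms (Suc q)" for xs
    unfolding df_mult_metric_form[abs_def] wedge_covector[of _ _ xs]
    by (intro alt_forms_sum alt_forms_scale inner_q)
qed

text \<open>For each \<open>e\<close>, apply \<open>wedge_covector_adjoint\<close> once in each
  argument. The sum over \<open>e\<close> of the resulting interior products is the
  contraction.\<close>

lemma df_inner_metric_form_contraction:
  fixes \<omega> \<eta> :: "'a::euclidean_space double_form"
  assumes \<eta>: "\<eta> \<in> double_forms (Suc p) (Suc q)"
  shows "df_inner (Suc p) (Suc q) (df_mult metric_form \<omega>) \<eta> = df_inner p q \<omega> (contraction \<eta>)"
proof -
  let ?L = "\<lambda>p. {xs :: 'a list. set xs \<subseteq> Basis \<and> length xs = p}"
  let ?W = "\<lambda>e. wedge (covector e)"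
  have \<eta>1: "(\<lambda>xs. \<eta> xs ys) \<in> alt_forms (Suc p)" and \<eta>2: "\<eta> xs \<in> alt_forms (Suc q)" for xs ys
    using \<eta> by (simp_all add: double_forms_def)
  have one: "(\<Sum>ys\<in>?L (Suc q). \<Sum>xs\<in>?L (Suc p). ?W e (\<lambda>zs. ?W e (\<omega> zs) ys) xs * \<eta> xs ys) =
      real (Suc p) * real (Suc q) * (\<Sum>zs\<in>?L p. \<Sum>ws\<in>?L q. \<omega> zs ws * \<eta> (e # zs) (e # ws))"
    if e: "e \<in> Basis" for e
  proof -
    have "(\<Sum>ys\<in>?L (Suc q). \<Sum>xs\<in>?L (Suc p). ?W e (\<lambda>zs. ?W e (\<omega> zs) ys) xs * \<eta> xs ys) =
        (\<Sum>ys\<in>?L (Suc q). Suc p * (\<Sum>zs\<in>?L p. ?W e (\<omega> zs) ys * \<eta> (e # zs) ys))"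
      by (intro sum.cong refl wedge_covector_adjoint[OF \<eta>1 e])
    \<comment> \<open>The swap makes \<open>ys\<close> the inner variable, so that the second
      adjunction can be applied to the form \<open>\<eta> (e # zs)\<close>.\<close>
    also have "\<dots> = Suc p * (\<Sum>zs\<in>?L p. \<Sum>ys\<in>?L (Suc q). ?W e (\<omega> zs) ys * \<eta> (e # zs) ys)"
      unfolding sum_distrib_left[symmetric] by (subst sum.swap) simp
    also have "\<dots> = Suc p * (\<Sum>zs\<in>?L p. Suc q * (\<Sum>ws\<in>?L q. \<omega> zs ws * \<eta> (e # zs) (e # ws)))"
      by (intro arg_cong[where f = "(*) (real (Suc p))"] sum.cong refl wedge_covector_adjoint[OF \<eta>2 e])
    finally show ?thesis
      by (simp only: sum_distrib_left mult.assoc)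
  qed
  have "(\<Sum>xs\<in>?L (Suc p). \<Sum>ys\<in>?L (Suc q). df_mult metric_form \<omega> xs ys * \<eta> xs ys) =
      (\<Sum>ys\<in>?L (Suc q). \<Sum>xs\<in>?L (Suc p). \<Sum>e\<in>Basis. ?W e (\<lambda>zs. ?W e (\<omega> zs) ys) xs * \<eta> xs ys)"
    unfolding df_mult_metric_form sum_distrib_right by (rule sum.swap)
  also have "\<dots> = (\<Sum>ys\<in>?L (Suc q). \<Sum>e\<in>Basis. \<Sum>xs\<in>?L (Suc p).
      ?W e (\<lambda>zs. ?W e (\<omega> zs) ys) xs * \<eta> xs ys)"
    by (rule sum.cong[OF refl], rule sum.swap)
  also have "\<dots> = (\<Sum>e\<in>Basis. \<Sum>ys\<in>?L (Suc q). \<Sum>xs\<in>?L (Suc p).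
      ?W e (\<lambda>zs. ?W e (\<omega> zs) ys) xs * \<eta> xs ys)"
    by (rule sum.swap)
  also have "\<dots> = real (Suc p) * real (Suc q) *
      (\<Sum>e\<in>Basis. \<Sum>zs\<in>?L p. \<Sum>ws\<in>?L q. \<omega> zs ws * \<eta> (e # zs) (e # ws))"
    unfolding sum_distrib_left[of _ _ Basis] by (rule sum.cong[OF refl one])
  also have "(\<Sum>e\<in>Basis. \<Sum>zs\<in>?L p. \<Sum>ws\<in>?L q. \<omega> zs ws * \<eta> (e # zs) (e # ws)) =
      (\<Sum>zs\<in>?L p. \<Sum>e\<in>Basis. \<Sum>ws\<in>?L q. \<omega> zs ws * \<eta> (e # zs) (e # ws))"
    by (rule sum.swap)
  also have "\<dots> = (\<Sum>zs\<in>?L p. \<Sum>ws\<in>?L q. \<omega> zs ws * contraction \<eta> zs ws)"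
    unfolding contraction_def sum_distrib_left by (rule sum.cong[OF refl], rule sum.swap)
  \<comment> \<open>The factors \<open>Suc p\<close> and \<open>Suc q\<close> cancel against the
    quotients of the factorials in the two normalisations.\<close>
  finally show ?thesis
    unfolding df_inner_def by (simp only: fact_Suc) (simp add: divide_simps)
qed

section \<open>Orthogonal decomposition\<close>

text \<open>
  The induction is on a set \<open>K\<close> of coordinates outside which \<open>W\<close> vanishes: a vector of \<open>W\<close> with
  nonzero coordinate \<open>k\<close>, made orthogonal to \<open>{w \<in> W. w k = 0}\<close>, completes this hyperplane of \<open>W\<close>.
\<close>

lemma orthogonal_projection_coordinates:
  fixes W :: "('k \<Rightarrow> real) set" and x :: "'k \<Rightarrow> real"
  assumes "finite L" "K \<subseteq> L" "W \<noteq> {}"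
    and "\<And>v w a. v \<in> W \<Longrightarrow> w \<in> W \<Longrightarrow> (\<lambda>k. v k + a * w k) \<in> W"
    and "\<And>w k. w \<in> W \<Longrightarrow> k \<in> L - K \<Longrightarrow> w k = 0"
  shows "\<exists>w\<in>W. \<forall>v\<in>W. (\<Sum>k\<in>L. (x k - w k) * v k) = 0"
  using finite_subset[OF assms(2,1)] assms(2-5)
proof (induction K arbitrary: W x rule: finite_induct)
  \<comment> \<open>Here all elements of \<open>W\<close> vanish on \<open>L\<close>, so any of them
    serves as the projection.\<close>
  case empty
  then obtain w where "w \<in> W" by auto
  moreover have "(\<Sum>k\<in>L. (x k - w k) * v k) = 0" if "v \<in> W" for v
    using empty that by (intro sum.neutral) auto
  ultimately show ?case by blast
next
  case (insert k K)
  note closed = insert.prems(3)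
  have vanish: "w j = 0" if "w \<in> W" "w k = 0" "j \<in> L - K" for w j
    using insert.prems(4) that by (cases "j = k") auto
  show ?case
  proof (cases "\<forall>w\<in>W. w k = 0")
    case True
    show ?thesis
    proof (rule insert.IH)
      show "K \<subseteq> L" using insert.prems(1) by simp
      show "w j = 0" if "w \<in> W" "j \<in> L - K" for w j
        using True that by (simp add: vanish)
    qed (fact insert.prems(2) closed)+
  next
    case False
    then obtain w0 where w0: "w0 \<in> W" "w0 k \<noteq> 0" by auto
    define W' where "W' = {w \<in> W. w k = 0}"
    \<comment> \<open>This is the zero vector, which lies in the hyperplane
      \<open>W'\<close>.\<close>
    have "(\<lambda>j. w0 j + (- 1) * w0 j) \<in> W"
      by (rule closed) (use w0 in auto)
    then have "W' \<noteq> {}" by (auto simp: W'_def)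
    have proj: "\<exists>w\<in>W'. \<forall>v\<in>W'. (\<Sum>j\<in>L. (y j - w j) * v j) = 0" for y
    proof (rule insert.IH)
      show "K \<subseteq> L" using insert.prems(1) by simp
      show "W' \<noteq> {}" by fact
      show "(\<lambda>j. v j + a * w j) \<in> W'" if "v \<in> W'" "w \<in> W'" for v w a
        using that closed[of v w a] by (simp add: W'_def)
      show "w j = 0" if "w \<in> W'" "j \<in> L - K" for w j
        using that by (simp add: W'_def vanish)
    qed
    obtain w1 where w1: "w1 \<in> W'" "\<And>v. v \<in> W' \<Longrightarrow> (\<Sum>j\<in>L. (w0 j - w1 j) * v j) = 0"
      using proj by blast
    obtain w2 where w2: "w2 \<in> W'" "\<And>v. v \<in> W' \<Longrightarrow> (\<Sum>j\<in>L. (x j - w2 j) * v j) = 0"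
      using proj by blast
    \<comment> \<open>The component of \<open>w0\<close> orthogonal to \<open>W'\<close>. It keeps
      the nonzero coordinate \<open>k\<close> because \<open>w1 k = 0\<close>.\<close>
    define u where "u j = w0 j - w1 j" for j
    have u: "u \<in> W" "u k \<noteq> 0" "\<And>v. v \<in> W' \<Longrightarrow> (\<Sum>j\<in>L. u j * v j) = 0"
      using closed[of w0 w1 "- 1"] w0 w1 by (auto simp: u_def[abs_def] W'_def)
    have "(\<Sum>j\<in>L. u j * u j) \<noteq> 0"
      using u(2) assms(1) insert.prems(1) by (auto simp: sum_nonneg_eq_0_iff)
    \<comment> \<open>The Gram-Schmidt coefficient: it corrects the projection \<open>w2\<close>
      onto \<open>W'\<close> by the component along \<open>u\<close>.\<close>
    define a where "a = (\<Sum>j\<in>L. (x j - w2 j) * u j) / (\<Sum>j\<in>L. u j * u j)"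
    define w where "w j = w2 j + a * u j" for j
    have w_u: "(\<Sum>j\<in>L. (x j - w j) * u j) = 0"
    proof -
      have "(\<Sum>j\<in>L. (x j - w j) * u j) = (\<Sum>j\<in>L. (x j - w2 j) * u j) - a * (\<Sum>j\<in>L. u j * u j)"
        by (simp add: w_def sum_distrib_left algebra_simps flip: sum_subtractf)
      then show ?thesis using \<open>(\<Sum>j\<in>L. u j * u j) \<noteq> 0\<close> by (simp add: a_def)
    qed
    have w_W': "(\<Sum>j\<in>L. (x j - w j) * v j) = 0" if "v \<in> W'" for v
    proof -
      have "(\<Sum>j\<in>L. (x j - w j) * v j) = (\<Sum>j\<in>L. (x j - w2 j) * v j) - a * (\<Sum>j\<in>L. u j * v j)"
        by (simp add: w_def sum_distrib_left algebra_simps flip: sum_subtractf)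
      then show ?thesis using w2(2) u(3) that by simp
    qed
    have "(\<Sum>j\<in>L. (x j - w j) * v j) = 0" if "v \<in> W" for v
    proof -
      \<comment> \<open>Chosen so that \<open>v - t u\<close> vanishes at \<open>k\<close>. Thus
        \<open>v\<close> splits into an element of \<open>W'\<close> and a multiple of
        \<open>u\<close>.\<close>
      define t where "t = v k / u k"
      have "(\<lambda>j. v j + (- t) * u j) \<in> W'"
        using closed[OF that u(1), of "- t"] u(2) by (simp add: W'_def t_def)
      from w_W'[OF this] have "(\<Sum>j\<in>L. (x j - w j) * v j) - t * (\<Sum>j\<in>L. (x j - w j) * u j) = 0"
        by (simp add: sum_distrib_left algebra_simps flip: sum_subtractf)
      then show ?thesis by (simp add: w_u)
    qed
    moreover have "w \<in> W"
      using closed[of w2 u a] w2 u by (simp add: w_def[abs_def] W'_def)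
    ultimately show ?thesis by blast
  qed
qed

text \<open>The form \<open>df_inner p q\<close> sees only the values at finitely many pairs of
  basis lists. With these pairs as coordinates, uncurrying reduces the claim to the previous lemma,
  and the factor \<open>1 / (fact p * fact q)\<close> does not affect orthogonality.\<close>

lemma df_orthogonal_projection:
  fixes S :: "'a::euclidean_space double_form set"
  assumes S: "df_subspace S"
  shows "\<exists>\<mu>\<in>S. \<forall>\<nu>\<in>S. df_inner p q (\<omega> - \<mu>) \<nu> = 0"
proof -
  let ?L = "\<lambda>p. {xs :: 'a list. set xs \<subseteq> Basis \<and> length xs = p}"
  let ?K = "?L p \<times> ?L q"
  have "\<exists>w\<in>case_prod ` S. \<forall>v\<in>case_prod ` S. (\<Sum>k\<in>?K. (case_prod \<omega> k - w k) * v k) = 0"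
  proof (rule orthogonal_projection_coordinates[of ?K ?K])
    show "finite ?K" by (simp add: finite_lists_length_eq)
    show "case_prod ` S \<noteq> {}" using S by (auto simp: df_subspace_iff)
    fix v w and a :: real assume "v \<in> case_prod ` S" "w \<in> case_prod ` S"
    then obtain \<mu> \<nu> where *: "\<mu> \<in> S" "\<nu> \<in> S" "v = case_prod \<mu>" "w = case_prod \<nu>" by auto
    then have "\<mu> + (\<lambda>xs ys. a * \<nu> xs ys) \<in> S" using S by (simp add: df_subspace_iff)
    moreover have "(\<lambda>k. v k + a * w k) = case_prod (\<mu> + (\<lambda>xs ys. a * \<nu> xs ys))"
      using * by (simp add: fun_eq_iff)
    ultimately show "(\<lambda>k. v k + a * w k) \<in> case_prod ` S" by blast
  qed auto
  then show ?thesis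
    by (simp add: df_inner_def sum.cartesian_product case_prod_unfold)
qed

section \<open>The two summands as subspaces\<close>

lemma contraction_add: "contraction (\<omega> + \<eta>) = contraction \<omega> + contraction \<eta>"
  by (simp add: fun_eq_iff contraction_def sum.distrib)

lemma contraction_scale: "contraction (\<lambda>xs ys. r * \<omega> xs ys) = (\<lambda>xs ys. r * contraction \<omega> xs ys)"
  by (simp add: fun_eq_iff contraction_def sum_distrib_left)

lemma df_subspace_contraction_kernel: "df_subspace (contraction_kernel p q)"
  using df_subspace_double_forms[of p q] unfolding df_subspace_iff
  by (auto simp: contraction_kernel_def contraction_add contraction_scale)
    (auto simp: contraction_def fun_eq_iff)

lemma df_subspace_metric_multiples: "df_subspace (metric_multiples p q)"
proof -
  have "df_mult metric_form 0 = 0"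
    by (simp add: fun_eq_iff df_mult_def)
  then show ?thesis
    using df_subspace_double_forms[of p q] unfolding df_subspace_iff metric_multiples_def
    by (auto simp flip: df_mult_add_right df_mult_scale_right intro: rev_image_eqI)
qed

theorem corollary3p6:
  fixes n p q :: nat
  assumes "DIM('a::euclidean_space) = n"
    and "p + q \<le> n - 1"
  shows "df_subspace (contraction_kernel (p + 1) (q + 1) :: 'a double_form set) \<and>
    df_subspace (metric_multiples p q :: 'a double_form set) \<and>
    (double_forms (p + 1) (q + 1) :: 'a double_form set)
      = contraction_kernel (p + 1) (q + 1) + metric_multiples p q \<and>
    contraction_kernel (p + 1) (q + 1) \<inter> metric_multiples p q = {0 :: 'a double_form} \<and>
    (\<forall>\<omega>\<in>contraction_kernel (p + 1) (q + 1). \<forall>\<eta>\<in>metric_multiples p q.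
      df_inner (p + 1) (q + 1) (\<omega> :: 'a double_form) \<eta> = 0)"
proof -
  let ?D = "double_forms (p + 1) (q + 1) :: 'a double_form set"
  let ?C = "contraction_kernel (p + 1) (q + 1) :: 'a double_form set"
  let ?M = "metric_multiples p q :: 'a double_form set"
  have CD: "?C \<subseteq> ?D" and MD: "?M \<subseteq> ?D"
    by (auto simp: contraction_kernel_def metric_multiples_def df_mult_metric_form_double_forms)
  have orth: "df_inner (p + 1) (q + 1) \<omega> \<eta> = 0" if "\<omega> \<in> ?C" "\<eta> \<in> ?M" for \<omega> \<eta>
  proof -
    obtain \<zeta> where "\<eta> = df_mult metric_form \<zeta>"
      using \<open>\<eta> \<in> ?M\<close> by (auto simp: metric_multiples_def)
    then have "df_inner (p + 1) (q + 1) \<eta> \<omega> = df_inner p q \<zeta> (contraction \<omega>)"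
      using \<open>\<omega> \<in> ?C\<close> by (simp add: contraction_kernel_def df_inner_metric_form_contraction)
    also have "\<dots> = 0"
      using \<open>\<omega> \<in> ?C\<close> by (simp add: contraction_kernel_def df_inner_def)
    finally show ?thesis
      by (simp only: df_inner_commute[of _ _ \<omega>])
  qed
  have "\<omega> \<in> ?C + ?M" if \<omega>: "\<omega> \<in> ?D" for \<omega>
  proof -
    \<comment> \<open>The candidate splitting: \<mu> is an orthogonal projection of \<omega> onto
      the metric multiples, and the remainder must be shown to have zero contraction.\<close>
    obtain \<mu> where \<mu>: "\<mu> \<in> ?M" "\<And>\<nu>. \<nu> \<in> ?M \<Longrightarrow> df_inner (p + 1) (q + 1) (\<omega> - \<mu>) \<nu> = 0"
      using df_orthogonal_projection[OF df_subspace_metric_multiples] by blast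
    have D: "\<omega> - \<mu> \<in> ?D"
      using df.subspace_diff[OF df_subspace_double_forms] \<omega> \<mu>(1) MD by blast
    then have cD: "contraction (\<omega> - \<mu>) \<in> double_forms p q"
      by (rule contraction_double_forms)
    \<comment> \<open>Test orthogonality against the metric times the contraction of the remainder
      itself. By adjointness this product is the squared norm of that contraction, which must
      therefore vanish.\<close>
    then have "df_inner (p + 1) (q + 1) (df_mult metric_form (contraction (\<omega> - \<mu>))) (\<omega> - \<mu>) = 0"
      by (subst df_inner_commute) (intro \<mu>(2), simp add: metric_multiples_def)
    then have "contraction (\<omega> - \<mu>) = 0"
      using D df_inner_self_eq_zero[OF cD] by (simp add: df_inner_metric_form_contraction)
    with D have "\<omega> - \<mu> \<in> ?C" by (simp add: contraction_kernel_def)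
    then have "(\<omega> - \<mu>) + \<mu> \<in> ?C + ?M" using \<mu>(1) by (rule set_plus_intro)
    then show ?thesis by simp
  qed
  moreover have "?C + ?M \<subseteq> ?D"
    using CD MD df_subspace_double_forms[of "p + 1" "q + 1"]
    by (auto simp: df_subspace_iff elim!: set_plus_elim)
  moreover have "?C \<inter> ?M = {0}"
  proof -
    \<comment> \<open>Such a form is orthogonal to itself.\<close>
    have "\<omega> = 0" if "\<omega> \<in> ?C" "\<omega> \<in> ?M" for \<omega>
      using df_inner_self_eq_zero orth CD that by blast
    then show ?thesis
      using df_subspace_contraction_kernel df_subspace_metric_multiples
      by (fastforce simp: df_subspace_iff)
  qed
  ultimately show ?thesis
    using df_subspace_contraction_kernel df_subspace_metric_multiples orth by auto
qed

end
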